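(* Suppose that $X\subseteq\mathbb{R}^{mn}$ is convex and closed, that the solution set $D^*$ of the problem $\min\{f(x) : x\in X,\ Ax=b\}$ is nonempty, and that $f:\mathbb{R}^{mn}\to\mathbb{R}$ is convex. If $I\subset J\subseteq L$ is a basic index set with respect to $J$, then $D^*_I=D^*_J$ and $Y^*_I\subseteq Y^*_J$.
   Context: Let $m,n,l$ be positive integers and $L=\{1,\dots,l\}$. Let $X\subseteq\mathbb{R}^{mn}$, $f:\mathbb{R}^{mn}\to\mathbb{R}$, let $A$ be a real matrix with $ln$ rows and $mn$ columns consisting of stacked $n\times mn$ blocks $A_1,\dots,A_l$, and let $b=(b_i)_{i\in L}\in\mathbb{R}^{ln}$ with $b_i\in\mathbb{R}^n$. For $I\subseteq L$, $A_I$ is the matrix of stacked blocks $A_i$, $i\in I$, and $b_I=(b_i)_{i\in I}$ (for $I=\varnothing$ the constraint $A_Ix=b_I$ is void). $D^*_I$ is the solution set of $\min\{f(x): x\in X,\ A_Ix=b_I\}$. For $I\subset J\subseteq L$ (equality allowed), $I$ is a basic index set with respect to $J$ if, for every $x\in\mathbb{R}^{mn}$, $A_Ix=b_I$ implies $A_Jx=b_J$. Lagrange function: $\mathcal{L}(x,y)=f(x)+\langle y,Ax-b\rangle$. For $I\subseteq L$ let $Y_I=\{y=(y_i)_{i\in L}\in\mathbb{R}^{ln} : y_i=\mathbf{0}\in\mathbb{R}^n \text{ for } i\notin I\}$. A pair $(x^*,y^* )\in X\times Y_I$ is a saddle point for index set $I$ if $\mathcal{L}(x^*,y)\le\mathcal{L}(x^*,y^*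 )\le\mathcal{L}(x,y^* )$ for all $y\in Y_I$ and all $x\in X$. The set of saddle points for $I$ is $W^*_I=D^*_I\times Y^*_I$, where $Y^*_I$ is the set of Lagrange multipliers, i.e. of those $y^*\in Y_I$ for which $(x^*,y^* )$ is a saddle point for $I$ for some $x^*\in X$. *)

theory Defs
  imports "HOL-Analysis.Analysis"
begin

text \<open>
  The positive integers m, n, l are the cardinalities of the finite index types \<open>'m\<close>, \<open>'n\<close>, \<open>'l\<close>,
  and the index set L is \<open>UNIV :: 'l set\<close>, so that \<open>J \<subseteq> L\<close> is implicit for \<open>J :: 'l set\<close>.
  The spaces of dimension mn and ln are \<open>real^('m \<times> 'n)\<close> and \<open>real^('l \<times> 'n)\<close>; a matrix of type
  \<open>real^('m \<times> 'n)^('l \<times> 'n)\<close> has its rows indexed by pairs (block number, row within the block).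
\<close>

text \<open>For a vector, \<open>block b i\<close> is the n-vector \<open>b\<^sub>i\<close>; for a matrix (a vector of
  rows), \<open>block A i\<close> is the n-row matrix \<open>A\<^sub>i\<close>.\<close>

definition block :: "'a^('l::finite \<times> 'n::finite) \<Rightarrow> 'l \<Rightarrow> 'a^'n" where
  "block v i = (\<chi> r. v $ (i, r))"

text \<open>The equation \<open>A\<^sub>I x = b\<^sub>I\<close>, written block by block because the number of rows of \<open>A\<^sub>I\<close>
  depends on \<open>I\<close>; it is void for \<open>I = {}\<close>.\<close>

definition satisfies_blocks ::
  "real^('m::finite \<times> 'n::finite)^('l::finite \<times> 'n) \<Rightarrow> real^('l \<times> 'n) \<Rightarrow> 'l set
     \<Rightarrow> real^('m \<times> 'n) \<Rightarrow> bool" where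
  "satisfies_blocks A b I x \<longleftrightarrow> (\<forall>i\<in>I. block A i *v x = block b i)"

definition solution_set :: "('a \<Rightarrow> real) \<Rightarrow> 'a set \<Rightarrow> 'a set" where
  "solution_set f S = {x. is_arg_min f (\<lambda>z. z \<in> S) x}"

definition block_solution_set ::
  "(real^('m::finite \<times> 'n::finite) \<Rightarrow> real) \<Rightarrow> (real^('m \<times> 'n)) set
     \<Rightarrow> real^('m \<times> 'n)^('l::finite \<times> 'n) \<Rightarrow> real^('l \<times> 'n) \<Rightarrow> 'l set
     \<Rightarrow> (real^('m \<times> 'n)) set" where
  "block_solution_set f X A b I = solution_set f {x \<in> X. satisfies_blocks A b I x}"

definition basic_index_set ::
  "real^('m::finite \<times> 'n::finite)^('l::finite \<times> 'n) \<Rightarrow> real^('l \<times> 'n) \<Rightarrow> 'l set \<Rightarrow> 'l set \<Rightarrow> bool" where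
  "basic_index_set A b I J \<longleftrightarrow>
     I \<subseteq> J \<and> (\<forall>x. satisfies_blocks A b I x \<longrightarrow> satisfies_blocks A b J x)"

definition lagrangian ::
  "(real^('m::finite \<times> 'n::finite) \<Rightarrow> real) \<Rightarrow> real^('m \<times> 'n)^('l::finite \<times> 'n) \<Rightarrow> real^('l \<times> 'n)
     \<Rightarrow> real^('m \<times> 'n) \<Rightarrow> real^('l \<times> 'n) \<Rightarrow> real" where
  "lagrangian f A b x y = f x + y \<bullet> (A *v x - b)"

definition dual_space :: "'l::finite set \<Rightarrow> (real^('l \<times> 'n::finite)) set" where
  "dual_space I = {y. \<forall>i. i \<notin> I \<longrightarrow> block y i = 0}"

definition saddle_point ::
  "(real^('m::finite \<times> 'n::finite) \<Rightarrow> real) \<Rightarrow> (real^('m \<times> 'n)) set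
     \<Rightarrow> real^('m \<times> 'n)^('l::finite \<times> 'n) \<Rightarrow> real^('l \<times> 'n) \<Rightarrow> 'l set
     \<Rightarrow> real^('m \<times> 'n) \<Rightarrow> real^('l \<times> 'n) \<Rightarrow> bool" where
  "saddle_point f X A b I x' y' \<longleftrightarrow>
     x' \<in> X \<and> y' \<in> dual_space I \<and>
     (\<forall>y\<in>dual_space I. lagrangian f A b x' y \<le> lagrangian f A b x' y') \<and>
     (\<forall>x\<in>X. lagrangian f A b x' y' \<le> lagrangian f A b x y')"

definition multiplier_set ::
  "(real^('m::finite \<times> 'n::finite) \<Rightarrow> real) \<Rightarrow> (real^('m \<times> 'n)) set
     \<Rightarrow> real^('m \<times> 'n)^('l::finite \<times> 'n) \<Rightarrow> real^('l \<times> 'n) \<Rightarrow> 'l set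
     \<Rightarrow> (real^('l \<times> 'n)) set" where
  "multiplier_set f X A b I = {y \<in> dual_space I. \<exists>x\<in>X. saddle_point f X A b I x y}"

end

theory Submission imports Defs begin

text \<open>
  A basic index set \<open>I\<close> cuts out the same feasible set as \<open>J\<close>: adding the constraints of \<open>J\<close> to
  those of \<open>I\<close> removes nothing. The two minimization problems are therefore literally the same.

  For the multipliers, the point is that the constraints \<open>A\<^sub>I x = b\<^sub>I\<close> say exactly that the residual
  \<open>A x - b\<close> is orthogonal to the subspace \<open>Y\<^sub>I\<close> (\<open>satisfies_blocks_iff_orthogonal\<close>), and that a
  linear functional attains a maximum on a subspace only if it vanishes there. Hence a pair
  \<open>(x, y)\<close> in \<open>X \<times> Y\<^sub>I\<close> is a saddle point for \<open>I\<close> if and only if \<open>x\<close> is feasible for \<open>I\<close> and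
  minimizes the Lagrangian at \<open>y\<close> over \<open>X\<close> (\<open>saddle_point_iff_feasible\<close>). The minimization
  condition is the same for all index sets, and \<open>Y\<^sub>I \<subseteq> Y\<^sub>J\<close>; since feasibility for \<open>I\<close> implies
  feasibility for \<open>J\<close>, every saddle point for \<open>I\<close> is also one for \<open>J\<close>.
\<close>

lemma satisfies_blocks_antimono:
  assumes "I \<subseteq> J" "satisfies_blocks A b J x"
  shows "satisfies_blocks A b I x"
  using assms by (auto simp: satisfies_blocks_def)

lemma satisfies_blocks_iff_residual:
  "satisfies_blocks A b I x \<longleftrightarrow> (\<forall>i\<in>I. block (A *v x - b) i = 0)"
  by (simp add: satisfies_blocks_def block_def vec_eq_iff matrix_vector_mult_def)

lemma inner_eq_sum_block: "y \<bullet> r = (\<Sum>i\<in>UNIV. block y i \<bullet> block r i)"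
  for y r :: "real^('l::finite \<times> 'n::finite)"
  by (simp add: block_def inner_vec_def sum.cartesian_product UNIV_Times_UNIV[symmetric]
           del: UNIV_Times_UNIV)

lemma subspace_dual_space: "subspace (dual_space I)"
  by (auto simp: subspace_def dual_space_def block_def vec_eq_iff)

lemma dual_space_mono: "I \<subseteq> J \<Longrightarrow> dual_space I \<subseteq> dual_space J"
  by (auto simp: dual_space_def)

text \<open>
  For the backward direction, the residual is tested against its own truncation to the blocks
  in \<open>I\<close>, with which its inner product is the sum of the squared norms of those blocks.
\<close>

lemma satisfies_blocks_iff_orthogonal:
  "satisfies_blocks A b I x \<longleftrightarrow> (\<forall>y\<in>dual_space I. y \<bullet> (A *v x - b) = 0)"
proof
  assume "satisfies_blocks A b I x"
  then have "block y i \<bullet> block (A *v x - b) i = 0" if "y \<in> dual_space I" for y i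
    using that by (cases "i \<in> I") (auto simp: satisfies_blocks_iff_residual dual_space_def)
  then show "\<forall>y\<in>dual_space I. y \<bullet> (A *v x - b) = 0"
    by (simp add: inner_eq_sum_block)
next
  define r where "r = A *v x - b"
  define p where "p = (\<chi> k. if fst k \<in> I then r $ k else 0)"
  have block_p: "block p i = (if i \<in> I then block r i else 0)" for i
    by (simp add: p_def block_def vec_eq_iff)
  assume "\<forall>y\<in>dual_space I. y \<bullet> (A *v x - b) = 0"
  moreover have "p \<in> dual_space I"
    by (simp add: dual_space_def block_p)
  ultimately have "p \<bullet> r = 0"
    by (simp add: r_def)
  moreover have "p \<bullet> r = p \<bullet> p"
    by (auto simp: inner_eq_sum_block block_p intro!: sum.cong)
  ultimately have "p = 0"
    by simp
  then have "block p i = 0" for i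
    by (simp add: block_def vec_eq_iff)
  then show "satisfies_blocks A b I x"
    unfolding satisfies_blocks_iff_residual r_def[symmetric] by (metis block_p)
qed

lemma maximum_on_subspace_iff_orthogonal:
  assumes "subspace S" "y' \<in> S"
  shows "(\<forall>y\<in>S. y \<bullet> r \<le> y' \<bullet> r) \<longleftrightarrow> (\<forall>y\<in>S. y \<bullet> r = 0)"
proof
  assume max: "\<forall>y\<in>S. y \<bullet> r \<le> y' \<bullet> r"
  show "\<forall>y\<in>S. y \<bullet> r = 0"
  proof
    fix y assume "y \<in> S"
    \<comment> \<open>Moving from the maximizer by \<open>y\<close> and by \<open>-y\<close> stays in \<open>S\<close>.\<close>
    then have "(y' + y) \<bullet> r \<le> y' \<bullet> r" "(y' - y) \<bullet> r \<le> y' \<bullet> r"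
      using max assms subspace_add subspace_diff by blast+
    then show "y \<bullet> r = 0"
      by (simp add: inner_add_left inner_diff_left)
  qed
qed (use assms in simp)

text \<open>
  The Lagrangian is affine in \<open>y\<close> with linear part \<open>A x - b\<close>, so the dual half of the saddle point
  condition is the maximization of a linear functional on a subspace; only feasibility is left
  of it.
\<close>

lemma saddle_point_iff_feasible:
  "saddle_point f X A b I x' y' \<longleftrightarrow>
     x' \<in> X \<and> y' \<in> dual_space I \<and> satisfies_blocks A b I x' \<and>
     (\<forall>x\<in>X. lagrangian f A b x' y' \<le> lagrangian f A b x y')"
proof -
  have "(\<forall>y\<in>dual_space I. lagrangian f A b x' y \<le> lagrangian f A b x' y')
      \<longleftrightarrow> satisfies_blocks A b I x'" if "y' \<in> dual_space I"
    using maximum_on_subspace_iff_orthogonal[OF subspace_dual_space that, of "A *v x' - b"]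
    by (simp add: lagrangian_def satisfies_blocks_iff_orthogonal)
  then show ?thesis
    by (auto simp: saddle_point_def)
qed

lemma satisfies_blocks_basic_index_set:
  assumes "basic_index_set A b I J"
  shows "satisfies_blocks A b I x \<longleftrightarrow> satisfies_blocks A b J x"
  using assms satisfies_blocks_antimono by (auto simp: basic_index_set_def)

lemma saddle_point_basic_index_set:
  assumes "basic_index_set A b I J" "saddle_point f X A b I x y"
  shows "saddle_point f X A b J x y"
  using assms dual_space_mono[of I J]
  by (auto simp: saddle_point_iff_feasible basic_index_set_def)

theorem proposition1:
  fixes f :: "real^('m::finite \<times> 'n::finite) \<Rightarrow> real"
    and X :: "(real^('m \<times> 'n)) set"
    and A :: "real^('m \<times> 'n)^('l::finite \<times> 'n)"
    and b :: "real^('l \<times> 'n)"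
    and I J :: "'l set"
  assumes "convex X" and "closed X"
    and "solution_set f {x \<in> X. A *v x = b} \<noteq> {}"
    and "convex_on UNIV f"
    and "I \<subseteq> J"
    and "basic_index_set A b I J"
  shows "block_solution_set f X A b I = block_solution_set f X A b J
       \<and> multiplier_set f X A b I \<subseteq> multiplier_set f X A b J"
proof
  show "block_solution_set f X A b I = block_solution_set f X A b J"
    using assms(6) by (simp add: block_solution_set_def satisfies_blocks_basic_index_set)
  show "multiplier_set f X A b I \<subseteq> multiplier_set f X A b J"
    using saddle_point_basic_index_set[OF assms(6)] dual_space_mono[OF assms(5)]
    unfolding multiplier_set_def by blast
qed

end
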